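(* TreeRes does not simulate MaxRes, and TreeRes does not simulate MaxResW.
   Context: A proof system $P$ simulates a proof system $P'$ if there is a polynomial $p$ such that every unsatisfiable CNF formula $F$ having a $P'$-refutation of size $s$ has a $P$-refutation of size at most $p(s+|F|)$, where $|F|$ is the size of $F$. Clauses are disjunctions of sets of literals with no complementary pair. $\Box$ is the empty clause. TreeRes (tree-like resolution): refutations using the resolution rule (from $C\vee x$ and $D\vee\overline{x}$ infer $C\vee D$), and optionally the weakening rule (from $C$ infer $C\vee x$), deriving $\Box$ from the clauses of $F$, where the underlying derivation graph is a tree. The size is the number of clauses (nodes) in the tree. MaxSAT resolution rule: from $x\vee A$ and $\overline{x}\vee B$ with $A=a_1\vee\dots\vee a_s$, $B=b_1\vee\dots\vee b_t$, derive $A\vee B$; the clauses $x\vee A\vee b_1\vee\dots\vee b_{j-1}\vee\overline{b_j}$ for $1\le j\le t$; and the clauses $\overline{x}\vee B\vee a_1\vee\dots\vee a_{j-1}\vee\overline{a_j}$ for $1\le j\le s$. MaxSAT weakening rule: replace a clause $A$ by the two clauses $A\vee x$ and $A\vee\overline{x}$. When a rule is applied to a multi-set of clauses, (one copy of) each antecedent is removed and all non-tautologous consequents are added. A MaxRes refutation of $F$ is a sequence of multi-sets $F=F_0,\dots,F_s$, each obtained from the previous one by one application of the MaxSAT resolution rule, with $\Box\in F_s$; its size is $s$. MaxResW is the same except that the MaxSAT weakening rule may also be used. *)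

theory Defs
  imports Main "HOL-Library.Multiset" "HOL-Computational_Algebra.Polynomial"
begin

datatype lit = Pos nat | Neg nat

fun compl_lit :: "lit \<Rightarrow> lit" where
  "compl_lit (Pos x) = Neg x"
| "compl_lit (Neg x) = Pos x"

type_synonym clause = "lit set"
type_synonym cnf = "clause set"

definition tautologous :: "clause \<Rightarrow> bool" where
  "tautologous C \<longleftrightarrow> (\<exists>l\<in>C. compl_lit l \<in> C)"

definition is_clause :: "clause \<Rightarrow> bool" where
  "is_clause C \<longleftrightarrow> finite C \<and> \<not> tautologous C"

definition is_cnf :: "cnf \<Rightarrow> bool" where
  "is_cnf F \<longleftrightarrow> finite F \<and> (\<forall>C\<in>F. is_clause C)"

fun sat_lit :: "(nat \<Rightarrow> bool) \<Rightarrow> lit \<Rightarrow> bool" where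
  "sat_lit \<alpha> (Pos x) = \<alpha> x"
| "sat_lit \<alpha> (Neg x) = (\<not> \<alpha> x)"

definition unsatisfiable :: "cnf \<Rightarrow> bool" where
  "unsatisfiable F \<longleftrightarrow> (\<nexists>\<alpha>. \<forall>C\<in>F. \<exists>l\<in>C. sat_lit \<alpha> l)"

text \<open>Literal occurrences plus one unit per clause, so that the size bounds both the number of
  clauses and the number of variables of a formula.\<close>
definition cnf_size :: "cnf \<Rightarrow> nat" where
  "cnf_size F = (\<Sum>C\<in>F. card C + 1)"

text \<open>A proof system is represented by the relation ``the formula \<open>F\<close> has a refutation of
  size \<open>s\<close>''.\<close>
type_synonym proof_system = "cnf \<Rightarrow> nat \<Rightarrow> bool"

definition simulates :: "proof_system \<Rightarrow> proof_system \<Rightarrow> bool" where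
  "simulates P P' \<longleftrightarrow>
     (\<exists>p :: real poly. \<forall>F s. is_cnf F \<and> unsatisfiable F \<and> P' F s \<longrightarrow>
        (\<exists>t. P F t \<and> real t \<le> poly p (real (s + cnf_size F))))"

text \<open>\<open>tree_derives F C s\<close>: there is a derivation tree with \<open>s\<close> nodes whose leaves are labelled
  by clauses of \<open>F\<close> and whose root is labelled by \<open>C\<close>. Weakening is admitted.\<close>
inductive tree_derives :: "cnf \<Rightarrow> clause \<Rightarrow> nat \<Rightarrow> bool" for F :: cnf where
  axiom: "C \<in> F \<Longrightarrow> tree_derives F C 1"
| resolution: "\<lbrakk>tree_derives F (insert (Pos x) C) s; tree_derives F (insert (Neg x) D) t;
     Pos x \<notin> C; Neg x \<notin> D; is_clause (C \<union> D)\<rbrakk> \<Longrightarrow> tree_derives F (C \<union> D) (s + t + 1)"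
| weakening: "\<lbrakk>tree_derives F C s; is_clause (insert l C)\<rbrakk> \<Longrightarrow>
     tree_derives F (insert l C) (s + 1)"

definition TreeRes :: proof_system where
  "TreeRes F s \<longleftrightarrow> tree_derives F {} s"

text \<open>The consequents of the MaxSAT resolution rule depend on the order in which the literals of
  the side clauses are enumerated, so these are given as lists. Indices here start at \<open>0\<close>.\<close>
definition side_clauses :: "lit \<Rightarrow> lit list \<Rightarrow> lit list \<Rightarrow> clause multiset" where
  "side_clauses l as bs =
     mset (map (\<lambda>j. {l} \<union> set as \<union> set (take j bs) \<union> {compl_lit (bs ! j)}) [0..<length bs])"

definition maxsat_consequents :: "nat \<Rightarrow> lit list \<Rightarrow> lit list \<Rightarrow> clause multiset" where
  "maxsat_consequents x as bs =
     {# set as \<union> set bs #} + side_clauses (Pos x) as bs + side_clauses (Neg x) bs as"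

definition replace_clauses ::
    "clause multiset \<Rightarrow> clause multiset \<Rightarrow> clause multiset \<Rightarrow> clause multiset" where
  "replace_clauses M A N = (M - A) + filter_mset (\<lambda>C. \<not> tautologous C) N"

text \<open>The premises of both rules are required to occur in \<open>M\<close> with multiplicity; the order of
  the literals in \<open>as\<close> and \<open>bs\<close> is a free choice of each resolution step.\<close>
inductive maxsat_resolution :: "clause multiset \<Rightarrow> clause multiset \<Rightarrow> bool" where
  "\<lbrakk>distinct as; distinct bs; Pos x \<notin> set as; Neg x \<notin> set bs;
    {# insert (Pos x) (set as), insert (Neg x) (set bs) #} \<subseteq># M\<rbrakk> \<Longrightarrow>
   maxsat_resolution M
     (replace_clauses M {# insert (Pos x) (set as), insert (Neg x) (set bs) #}
        (maxsat_consequents x as bs))"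

inductive maxsat_weakening :: "clause multiset \<Rightarrow> clause multiset \<Rightarrow> bool" where
  "A \<in># M \<Longrightarrow> maxsat_weakening M
     (replace_clauses M {# A #} {# insert (Pos x) A, insert (Neg x) A #})"

text \<open>A formula is a set of clauses; a refutation starts from the multiset containing each of them
  once. The size is the number of rule applications.\<close>
definition MaxRes :: proof_system where
  "MaxRes F s \<longleftrightarrow> (\<exists>M. (maxsat_resolution ^^ s) (mset_set F) M \<and> {} \<in># M)"

definition MaxResW :: proof_system where
  "MaxResW F s \<longleftrightarrow>
     (\<exists>M. ((\<lambda>K L. maxsat_resolution K L \<or> maxsat_weakening K L) ^^ s) (mset_set F) M \<and> {} \<in># M)"

end

theory Submission
  imports Defs "HOL-Library.Nat_Bijection" "HOL-Real_Asymp.Real_Asymp"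
begin

text \<open>The separating formula follows a path through a grid of \<open>n\<close> layers with \<open>2 n\<close> nodes each: the
  first node is active, an active node points to an active node of the next layer, no node of the
  last layer is active, and, crucially for MaxRes, no node pointed to by an active node is pointed
  to by another node.

  A resolution refutation goes backwards through the layers and derives that each node is inactive.
  It uses this clause once for every possible predecessor. MaxRes consumes the clause, but as
  predecessors are unique, the uses concern disjoint sets of assignments, and what each use leaves
  behind is enough for the remaining ones.

  For tree-like resolution, a Delayer wins \<open>n\<close> points in the Prover-Delayer game: every query either has a harmless answer,
  makes at most two nodes inactive, or extends the active path by one layer; in the last two cases the
  Prover may choose the answer.\<close>

section \<open>The Prover-Delayer game\<close>

fun lit_true :: "(nat \<Rightarrow> bool option) \<Rightarrow> lit \<Rightarrow> bool" where
  "lit_true \<rho> (Pos x) \<longleftrightarrow> \<rho> x = Some True"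
| "lit_true \<rho> (Neg x) \<longleftrightarrow> \<rho> x = Some False"

fun lit_false :: "(nat \<Rightarrow> bool option) \<Rightarrow> lit \<Rightarrow> bool" where
  "lit_false \<rho> (Pos x) \<longleftrightarrow> \<rho> x = Some False"
| "lit_false \<rho> (Neg x) \<longleftrightarrow> \<rho> x = Some True"

lemma lit_true_mono: "\<rho> \<subseteq>\<^sub>m \<rho>' \<Longrightarrow> lit_true \<rho> l \<Longrightarrow> lit_true \<rho>' l"
  by (cases l) (auto simp: map_le_def dom_def)

lemma lit_false_mono: "\<rho> \<subseteq>\<^sub>m \<rho>' \<Longrightarrow> lit_false \<rho> l \<Longrightarrow> lit_false \<rho>' l"
  by (cases l) (auto simp: map_le_def dom_def)

lemma lit_true_not_false: "lit_true \<rho> l \<Longrightarrow> \<not> lit_false \<rho> l"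
  by (cases l) auto

text \<open>\<open>Q \<rho> p\<close> reads: at \<open>\<rho>\<close> the Delayer can still win
  \<open>p\<close> points. Descending from a falsified clause, each resolution step queries its
  pivot. A scored point makes both subtrees large, which doubles the bound, and a leaf is a
  falsified axiom, where \<open>ax\<close> leaves no points.\<close>

lemma delayer_lower_bound:
  assumes ax: "\<And>\<rho> p C. Q \<rho> (Suc p) \<Longrightarrow> C \<in> F \<Longrightarrow> \<exists>l\<in>C. \<not> lit_false \<rho> l"
  assumes query: "\<And>\<rho> p x. Q \<rho> (Suc p) \<Longrightarrow> \<rho> x = None \<Longrightarrow>
    (\<exists>\<rho>' b. \<rho> \<subseteq>\<^sub>m \<rho>' \<and> \<rho>' x = Some b \<and> Q \<rho>' (Suc p)) \<or>
    (\<forall>b. \<exists>\<rho>'. \<rho> \<subseteq>\<^sub>m \<rho>' \<and> \<rho>' x = Some b \<and> Q \<rho>' p)"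
  assumes "tree_derives F C s" "Q \<rho> p" "\<forall>l\<in>C. lit_false \<rho> l"
  shows "2 ^ p \<le> s"
  using assms(3-)
proof (induction arbitrary: \<rho> p rule: tree_derives.induct)
  case (axiom C)
  then show ?case
  proof (cases p)
    case (Suc q)
    then show ?thesis using ax[of \<rho> q C] axiom by blast
  qed simp
next
  case (weakening C s l)
  have "2 ^ p \<le> s" by (rule weakening.IH) (use weakening.prems in auto)
  then show ?case by simp
next
  case (resolution x C s D t)
  have L: "2 ^ q \<le> s" if "Q \<rho>' q" "\<rho> \<subseteq>\<^sub>m \<rho>'" "\<rho>' x = Some False" for \<rho>' q
    by (rule resolution.IH(1)[of \<rho>'])
      (use that resolution.prems lit_false_mono[OF that(2)] in auto)
  have R: "2 ^ q \<le> t" if "Q \<rho>' q" "\<rho> \<subseteq>\<^sub>m \<rho>'" "\<rho>' x = Some True" for \<rho>' q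
    by (rule resolution.IH(2)[of \<rho>'])
      (use that resolution.prems lit_false_mono[OF that(2)] in auto)
  show ?case
  proof (cases p)
    case 0
    then show ?thesis by simp
  next
    case (Suc q)
    \<comment> \<open>If no point is spent, the premise falsified by the answer alone is large
      enough. This serves both a pivot that \<open>\<rho>\<close> already assigns and a harmless
      answer.\<close>
    have one: ?thesis if "Q \<rho>' p" "\<rho> \<subseteq>\<^sub>m \<rho>'" "\<rho>' x = Some b" for \<rho>' b
      using L[OF that(1,2)] R[OF that(1,2)] that(3) by (cases b) auto
    show ?thesis
    proof (cases "\<rho> x")
      case (Some b)
      then show ?thesis using one[OF resolution.prems(1) _ Some] by simp
    next
      case None
      from query[OF resolution.prems(1)[unfolded Suc] None] show ?thesis
      proof
        assume "\<exists>\<rho>' b. \<rho> \<subseteq>\<^sub>m \<rho>' \<and> \<rho>' x = Some b \<and> Q \<rho>' (Suc q)"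
        then show ?thesis using one Suc by blast
      next
        assume *: "\<forall>b. \<exists>\<rho>'. \<rho> \<subseteq>\<^sub>m \<rho>' \<and> \<rho>' x = Some b \<and> Q \<rho>' q"
        have "2 ^ q \<le> s" using * L by blast
        moreover have "2 ^ q \<le> t" using * R by blast
        ultimately show ?thesis using Suc by simp
      qed
    qed
  qed
qed

section \<open>The formulas\<close>

definition av :: "nat \<Rightarrow> nat \<Rightarrow> nat" where
  "av i j = prod_encode (0, prod_encode (i, j))"

definition bv :: "nat \<Rightarrow> nat \<Rightarrow> nat" where
  "bv i j = prod_encode (1, prod_encode (i, j))"

definition sv :: "nat \<Rightarrow> nat \<Rightarrow> nat \<Rightarrow> nat" where
  "sv i j k = prod_encode (2, prod_encode (i, prod_encode (j, k)))"

lemma var_eq [simp]: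
  "av i j = av i' j' \<longleftrightarrow> i = i' \<and> j = j'"
  "bv i j = bv i' j' \<longleftrightarrow> i = i' \<and> j = j'"
  "sv i j k = sv i' j' k' \<longleftrightarrow> i = i' \<and> j = j' \<and> k = k'"
  "av i j \<noteq> bv i' j'" "av i j \<noteq> sv i' j' k'" "bv i j \<noteq> sv i' j' k'"
  "bv i' j' \<noteq> av i j" "sv i' j' k' \<noteq> av i j" "sv i' j' k' \<noteq> bv i j"
  by (auto simp: av_def bv_def sv_def prod_encode_eq)

text \<open>Node \<open>(i, j)\<close> of layer \<open>i\<close> is active iff \<open>av i j\<close> and \<open>bv i j\<close> both hold, and \<open>sv i j k\<close>
  says that it points to node \<open>(i + 1, k)\<close>. Two variables per node are needed: with only one, unit
  propagation would give a short tree-like refutation.\<close>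

definition inactive :: "nat \<Rightarrow> nat \<Rightarrow> clause" where
  "inactive i j = {Neg (av i j), Neg (bv i j)}"

definition no_edge :: "nat \<Rightarrow> nat \<Rightarrow> nat \<Rightarrow> clause" where
  "no_edge i j k = {Neg (av i j), Neg (bv i j), Neg (sv i j k)}"

definition has_edge :: "nat \<Rightarrow> nat \<Rightarrow> nat \<Rightarrow> clause" where
  "has_edge m i j = inactive i j \<union> (\<lambda>k. Pos (sv i j k)) ` {..<m}"

definition edge_a :: "nat \<Rightarrow> nat \<Rightarrow> nat \<Rightarrow> clause" where
  "edge_a i j k = insert (Pos (av (Suc i) k)) (no_edge i j k)"

definition edge_b :: "nat \<Rightarrow> nat \<Rightarrow> nat \<Rightarrow> clause" where
  "edge_b i j k = insert (Pos (bv (Suc i) k)) (no_edge i j k)"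

text \<open>Only \<open>j\<close> is assumed active, not \<open>j'\<close>. Resolving on
  \<open>sv i j' k\<close> therefore brings in no literals beyond those of
  \<open>no_edge i j k\<close>.\<close>

definition edge_inj :: "nat \<Rightarrow> nat \<Rightarrow> nat \<Rightarrow> nat \<Rightarrow> clause" where
  "edge_inj i k j j' = insert (Neg (sv i j' k)) (no_edge i j k)"

lemmas clause_defs = inactive_def no_edge_def has_edge_def edge_a_def edge_b_def edge_inj_def

text \<open>Injectivity is stated for \<open>j' < j\<close> only: the MaxRes refutation treats the
  predecessors of a node in increasing order and uses up each of these clauses once.\<close>

definition layer :: "nat \<Rightarrow> nat \<Rightarrow> cnf" where
  "layer m i = has_edge m i ` {..<m}
     \<union> (\<lambda>(j, k). edge_a i j k) ` ({..<m} \<times> {..<m})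
     \<union> (\<lambda>(j, k). edge_b i j k) ` ({..<m} \<times> {..<m})
     \<union> (\<lambda>(k, j, j'). edge_inj i k j j') ` ({..<m} \<times> (SIGMA j:{..<m}. {..<j}))"

definition path_cnf :: "nat \<Rightarrow> nat \<Rightarrow> cnf" where
  "path_cnf n m = {{Pos (av 0 0)}, {Pos (bv 0 0)}} \<union> (\<Union>i<n. layer m i) \<union> inactive n ` {..<m}"

lemma is_cnf_path_cnf: "is_cnf (path_cnf n m)"
  by (auto simp: is_cnf_def path_cnf_def layer_def is_clause_def tautologous_def clause_defs)

text \<open>A satisfying assignment would carry an active node from each layer to the next, starting
  at node 0 of layer 0, until the last layer forbids it.\<close>

lemma unsatisfiable_path_cnf:
  assumes "m > 0"
  shows "unsatisfiable (path_cnf n m)"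
  unfolding unsatisfiable_def
proof
  assume "\<exists>\<alpha>. \<forall>C\<in>path_cnf n m. \<exists>l\<in>C. sat_lit \<alpha> l"
  then obtain \<alpha> where \<alpha>: "\<And>C. C \<in> path_cnf n m \<Longrightarrow> \<exists>l\<in>C. sat_lit \<alpha> l" by blast
  have "i \<le> n \<Longrightarrow> \<exists>j<m. \<alpha> (av i j) \<and> \<alpha> (bv i j)" for i
  proof (induction i)
    case 0
    have "{Pos (av 0 0)} \<in> path_cnf n m" "{Pos (bv 0 0)} \<in> path_cnf n m"
      by (auto simp: path_cnf_def)
    then show ?case using \<alpha> assms by fastforce
  next
    case (Suc i)
    then obtain j where j: "j < m" "\<alpha> (av i j)" "\<alpha> (bv i j)" by auto
    have sub: "layer m i \<subseteq> path_cnf n m" using Suc.prems by (auto simp: path_cnf_def)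
    have "has_edge m i j \<in> path_cnf n m" using sub j(1) by (auto simp: layer_def)
    from \<alpha>[OF this] j obtain k where k: "k < m" "\<alpha> (sv i j k)"
      by (auto simp: clause_defs)
    have "edge_a i j k \<in> path_cnf n m" "edge_b i j k \<in> path_cnf n m"
      using sub j(1) k(1) by (force simp: layer_def)+
    from \<alpha>[OF this(1)] \<alpha>[OF this(2)] j k show ?case by (auto simp: clause_defs)
  qed
  then obtain j where j: "j < m" "\<alpha> (av n j)" "\<alpha> (bv n j)" by auto
  have "inactive n j \<in> path_cnf n m" using j by (auto simp: path_cnf_def)
  from \<alpha>[OF this] j show False by (auto simp: clause_defs)
qed

section \<open>Polynomial bounds on the size of the formulas\<close>

lemma finite_layer: "finite (layer m i)"
  by (auto simp: layer_def)

lemma card_layer: "card (layer m i) \<le> m + 2 * m\<^sup>2 + m ^ 3"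
proof -
  have *: "card (SIGMA j:{..<m}. {..<j}) \<le> m\<^sup>2"
  proof -
    have "card (SIGMA j:{..<m}. {..<j}) \<le> card ({..<m} \<times> {..<m})"
      by (rule card_mono) auto
    then show ?thesis by (simp add: power2_eq_square)
  qed
  have 1: "card (has_edge m i ` {..<m}) \<le> m"
    using card_image_le[of "{..<m}"] by simp
  have 2: "card ((\<lambda>(j, k). f j k) ` ({..<m} \<times> {..<m})) \<le> m\<^sup>2" for f :: "nat \<Rightarrow> nat \<Rightarrow> clause"
    using card_image_le[of "{..<m} \<times> {..<m}"] by (simp add: power2_eq_square)
  have "card ((\<lambda>(k, j, j'). edge_inj i k j j') ` ({..<m} \<times> (SIGMA j:{..<m}. {..<j})))
      \<le> card ({..<m} \<times> (SIGMA j:{..<m}. {..<j}))"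
    by (rule card_image_le) auto
  also have "\<dots> \<le> m ^ 3" using * by (simp add: card_cartesian_product power3_eq_cube power2_eq_square)
  finally have 3: "card ((\<lambda>(k, j, j'). edge_inj i k j j') ` ({..<m} \<times> (SIGMA j:{..<m}. {..<j}))) \<le> m ^ 3" .
  show ?thesis
    unfolding layer_def
    by (rule order.trans[OF card_Un_le] order.trans[OF add_mono[OF card_Un_le order.refl]]
        order.trans[OF add_mono[OF add_mono[OF card_Un_le order.refl] order.refl]])+
      (use 1 2[of "edge_a i"] 2[of "edge_b i"] 3 in linarith)
qed

text \<open>The clauses \<open>has_edge\<close> have \<open>m + 2\<close> literals and all others at
  most four; \<open>m + 4\<close> covers both.\<close>

lemma card_path_clause: "C \<in> path_cnf n m \<Longrightarrow> card C \<le> m + 4"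
proof -
  have h: "card (has_edge m i j) \<le> m + 4" for i j
  proof -
    have "card (has_edge m i j) \<le> card (inactive i j) + card ((\<lambda>k. Pos (sv i j k)) ` {..<m})"
      unfolding has_edge_def by (rule card_Un_le)
    also have "\<dots> \<le> 2 + m"
      by (intro add_mono) (use card_image_le[of "{..<m}"] in \<open>auto simp: clause_defs\<close>)
    finally show ?thesis by simp
  qed
  assume "C \<in> path_cnf n m"
  then show ?thesis
    by (auto simp: path_cnf_def layer_def h)
      (auto simp: clause_defs card_insert_if)
qed

lemma cnf_size_path_cnf: "cnf_size (path_cnf n m) \<le> (2 + n * (m + 2 * m\<^sup>2 + m ^ 3) + m) * (m + 5)"
proof -
  have "cnf_size (path_cnf n m) \<le> card (path_cnf n m) * (m + 5)"
    unfolding cnf_size_def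
    using sum_bounded_above[of "path_cnf n m" "\<lambda>C. card C + 1" "m + 5"] card_path_clause
    by fastforce
  moreover have "card (path_cnf n m) \<le> 2 + n * (m + 2 * m\<^sup>2 + m ^ 3) + m"
  proof -
    have "card {{Pos (av 0 0)}, {Pos (bv 0 0)}} \<le> 2" by (simp add: card_insert_if)
    moreover have "card (\<Union>i<n. layer m i) \<le> n * (m + 2 * m\<^sup>2 + m ^ 3)"
      using card_UN_le[of "{..<n}" "layer m"]
        sum_bounded_above[of "{..<n}" "\<lambda>i. card (layer m i)", OF card_layer[of m]]
      by (simp add: order.trans)
    moreover have "card (inactive n ` {..<m}) \<le> m" using card_image_le[of "{..<m}"] by simp
    ultimately show ?thesis
      unfolding path_cnf_def
      by (intro order.trans[OF card_Un_le] add_mono)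
  qed
  ultimately show ?thesis by (meson mult_le_mono1 order.trans)
qed


section \<open>The Delayer's strategy\<close>

text \<open>The active path has been followed down to its head \<open>(h, c)\<close>, whose out-edges are still
  undetermined, and \<open>T\<close> collects nodes that were made inactive. All other nodes in layers
  \<open>\<ge> h\<close> are untouched. Pointers between inactive nodes are harmless as long as
  their targets are inactive, too.\<close>
definition position ::
    "nat \<Rightarrow> (nat \<Rightarrow> bool option) \<Rightarrow> nat \<Rightarrow> nat \<Rightarrow> (nat \<times> nat) set \<Rightarrow> bool" where
  "position m \<rho> h c T \<longleftrightarrow> finite T \<and>
     \<rho> (av 0 0) = Some True \<and> \<rho> (bv 0 0) = Some True \<and>
     (\<forall>i<h. \<forall>C\<in>layer m i. \<exists>l\<in>C. lit_true \<rho> l) \<and>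
     \<rho> (av h c) = Some True \<and> \<rho> (bv h c) = Some True \<and> (h, c) \<notin> T \<and>
     (\<forall>k. \<rho> (sv h c k) \<noteq> Some True) \<and>
     (\<forall>k<m. \<rho> (sv h c k) = Some False \<longrightarrow> (Suc h, k) \<in> T) \<and>
     (\<forall>i j. (i, j) \<in> T \<longrightarrow> \<rho> (av i j) = Some False \<or> \<rho> (bv i j) = Some False) \<and>
     (\<forall>i j. h \<le> i \<longrightarrow> (i, j) \<notin> T \<longrightarrow> (i, j) \<noteq> (h, c) \<longrightarrow>
        \<rho> (av i j) = None \<and> \<rho> (bv i j) = None \<and> (\<forall>k. \<rho> (sv i j k) = None)) \<and>
     (\<forall>i j k. h \<le> i \<longrightarrow> (i, j) \<in> T \<longrightarrow> \<rho> (sv i j k) = Some True \<longrightarrow> (Suc i, k) \<in> T)"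

section \<open>Updates of a position\<close>

lemma map_le_upd_None: "\<rho> x = None \<Longrightarrow> \<rho> \<subseteq>\<^sub>m \<rho>(x \<mapsto> b)"
  by (auto simp: map_le_def)

lemma satisfied_mono:
  assumes "\<forall>i<h. \<forall>C\<in>layer m i. \<exists>l\<in>C. lit_true \<rho> l" "\<rho> \<subseteq>\<^sub>m \<rho>'"
  shows "\<forall>i<h. \<forall>C\<in>layer m i. \<exists>l\<in>C. lit_true \<rho>' l"
  using assms lit_true_mono by blast

text \<open>Common part of all moves that keep the head. Satisfied layers and dead nodes survive any
  extension of \<open>\<rho>\<close>, so only the head's pointers, the newly dead nodes, the
  untouched nodes and the pointers of dead nodes have to be checked.\<close>

lemma position_mono:
  assumes P: "position m \<rho> h c T" and le: "\<rho> \<subseteq>\<^sub>m \<rho>'"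
    and T': "finite T'" "T \<subseteq> T'" "(h, c) \<notin> T'"
    and "\<And>k. \<rho>' (sv h c k) \<noteq> Some True"
    and "\<And>k. k < m \<Longrightarrow> \<rho>' (sv h c k) = Some False \<Longrightarrow> (Suc h, k) \<in> T'"
    and new: "\<And>i j. (i, j) \<in> T' - T \<Longrightarrow> \<rho>' (av i j) = Some False \<or> \<rho>' (bv i j) = Some False"
    and "\<And>i j k. h \<le> i \<Longrightarrow> (i, j) \<notin> T' \<Longrightarrow> (i, j) \<noteq> (h, c) \<Longrightarrow>
      \<rho>' (av i j) = \<rho> (av i j) \<and> \<rho>' (bv i j) = \<rho> (bv i j) \<and> \<rho>' (sv i j k) = \<rho> (sv i j k)"
    and "\<And>i j k. h \<le> i \<Longrightarrow> (i, j) \<in> T' \<Longrightarrow> \<rho>' (sv i j k) = Some True \<Longrightarrow> (Suc i, k) \<in> T'"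
  shows "position m \<rho>' h c T'"
proof -
  have mono: "\<rho>' x = Some v" if "\<rho> x = Some v" for x v
    using le that by (metis domI map_le_def)
  have dead: "\<rho>' (av i j) = Some False \<or> \<rho>' (bv i j) = Some False" if "(i, j) \<in> T'" for i j
  proof (cases "(i, j) \<in> T")
    case True
    then have "\<rho> (av i j) = Some False \<or> \<rho> (bv i j) = Some False"
      using P unfolding position_def by blast
    then show ?thesis using mono by blast
  next
    case False
    then show ?thesis using new that by blast
  qed
  have untouched: "\<rho>' (av i j) = None \<and> \<rho>' (bv i j) = None \<and> (\<forall>k. \<rho>' (sv i j k) = None)"
    if "h \<le> i" "(i, j) \<notin> T'" "(i, j) \<noteq> (h, c)" for i j
  proof -
    have "\<rho> (av i j) = None \<and> \<rho> (bv i j) = None \<and> (\<forall>k. \<rho> (sv i j k) = None)"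
      using P that T'(2) unfolding position_def by blast
    then show ?thesis using assms(9)[OF that] by simp
  qed
  have sat: "\<forall>i<h. \<forall>C\<in>layer m i. \<exists>l\<in>C. lit_true \<rho>' l"
    by (rule satisfied_mono[OF _ le]) (use P in \<open>simp add: position_def\<close>)
  have active: "\<rho>' (av 0 0) = Some True" "\<rho>' (bv 0 0) = Some True"
    "\<rho>' (av h c) = Some True" "\<rho>' (bv h c) = Some True"
    by (rule mono, use P in \<open>simp add: position_def\<close>)+
  show ?thesis
    unfolding position_def
    by (intro conjI allI impI T' sat active dead assms(6,7) untouched[THEN conjunct1]
        untouched[THEN conjunct2, THEN conjunct1] untouched[THEN conjunct2, THEN conjunct2, rule_format])
      (use assms(10) in blast)+
qed

text \<open>The harmless answers. They concern finished layers, dead nodes, pointers from the head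
  to dead nodes, and variables foreign to the grid. \<open>False\<close> creates no new pointer, so
  nothing is owed about targets.\<close>

lemma position_free:
  assumes P: "position m \<rho> h c T" and x: "\<rho> x = None"
    and "\<And>i j. h \<le> i \<Longrightarrow> (i, j) \<notin> T \<Longrightarrow> (i, j) \<noteq> (h, c) \<Longrightarrow>
      x \<noteq> av i j \<and> x \<noteq> bv i j \<and> (\<forall>k. x \<noteq> sv i j k)"
    and "\<And>k. k < m \<Longrightarrow> x = sv h c k \<Longrightarrow> (Suc h, k) \<in> T"
  shows "position m (\<rho>(x \<mapsto> False)) h c T"
proof (rule position_mono[OF P])
  show "\<rho> \<subseteq>\<^sub>m \<rho>(x \<mapsto> False)" using x by (rule map_le_upd_None)
  show "(\<rho>(x \<mapsto> False)) (sv h c k) \<noteq> Some True" for k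
    using P by (simp add: position_def)
  show "(Suc h, k) \<in> T" if "k < m" "(\<rho>(x \<mapsto> False)) (sv h c k) = Some False" for k
    using P that assms(4)[of k] by (auto simp: position_def split: if_splits)
  show "(Suc i, k) \<in> T" if "h \<le> i" "(i, j) \<in> T" "(\<rho>(x \<mapsto> False)) (sv i j k) = Some True" for i j k
  proof -
    have "\<rho> (sv i j k) = Some True" using that(3) by (simp split: if_splits)
    then show ?thesis using P that unfolding position_def by blast
  qed
  show "(\<rho>(x \<mapsto> False)) (av i j) = \<rho> (av i j) \<and> (\<rho>(x \<mapsto> False)) (bv i j) = \<rho> (bv i j) \<and>
      (\<rho>(x \<mapsto> False)) (sv i j k) = \<rho> (sv i j k)"
    if "h \<le> i" "(i, j) \<notin> T" "(i, j) \<noteq> (h, c)" for i j k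
    using assms(3)[OF that] by (metis fun_upd_apply)
qed (use P in \<open>auto simp: position_def\<close>)

text \<open>Both variables of the node are set at once. One false value suffices, so the queried
  variable may take either value; this is what the two variables per node are for.\<close>

lemma position_kill:
  assumes P: "position m \<rho> h c T" and "h \<le> i" "(i, j) \<notin> T" "(i, j) \<noteq> (h, c)"
    and vw: "\<not> (v \<and> w)"
  shows "position m (\<rho>(av i j \<mapsto> v, bv i j \<mapsto> w)) h c (insert (i, j) T)"
    and "\<rho> \<subseteq>\<^sub>m \<rho>(av i j \<mapsto> v, bv i j \<mapsto> w)"
proof -
  let ?\<rho> = "\<rho>(av i j \<mapsto> v, bv i j \<mapsto> w)"
  have None: "\<rho> (av i j) = None" "\<rho> (bv i j) = None" "\<And>k. \<rho> (sv i j k) = None"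
    using assms(1-4) unfolding position_def by blast+
  then show le: "\<rho> \<subseteq>\<^sub>m ?\<rho>" by (auto simp: map_le_def)
  show "position m ?\<rho> h c (insert (i, j) T)"
  proof (rule position_mono[OF P le])
    show "(Suc i', k) \<in> insert (i, j) T"
      if "h \<le> i'" "(i', j') \<in> insert (i, j) T" "?\<rho> (sv i' j' k) = Some True" for i' j' k
    proof -
      have "\<rho> (sv i' j' k) = Some True" using that(3) by simp
      \<comment> \<open>The node just made inactive has no pointers set yet.\<close>
      then have "(i', j') \<in> T" using that(2) None by auto
      then show ?thesis using P that(1) \<open>\<rho> (sv i' j' k) = Some True\<close>
        unfolding position_def by blast
    qed
  qed (use P assms(4) vw in \<open>auto simp: position_def\<close>)
qed

lemma position_dead_edge:
  assumes P: "position m \<rho> h c T" and x: "\<rho> (sv i j k) = None"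
    and "h \<le> i" and ij: "(i, j) \<in> T" "(Suc i, k) \<in> T"
  shows "position m (\<rho>(sv i j k \<mapsto> v)) h c T"
proof (rule position_mono[OF P])
  \<comment> \<open>The head is never in \<open>T\<close>, so its own pointers are
    unaffected.\<close>
  have "(i, j) \<noteq> (h, c)" using P ij by (auto simp: position_def)
  then have head: "(\<rho>(sv i j k \<mapsto> v)) (sv h c l) = \<rho> (sv h c l)" for l by auto
  show "\<rho> \<subseteq>\<^sub>m \<rho>(sv i j k \<mapsto> v)" using x by (rule map_le_upd_None)
  show "(\<rho>(sv i j k \<mapsto> v)) (sv h c l) \<noteq> Some True" for l
    using P unfolding head position_def by blast
  show "(Suc h, l) \<in> T" if "l < m" "(\<rho>(sv i j k \<mapsto> v)) (sv h c l) = Some False" for l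
    using P that unfolding head position_def by blast
  show "(Suc i', l) \<in> T"
    if "h \<le> i'" "(i', j') \<in> T" "(\<rho>(sv i j k \<mapsto> v)) (sv i' j' l) = Some True" for i' j' l
  proof (cases "(i', j', l) = (i, j, k)")
    case False
    then have "\<rho> (sv i' j' l) = Some True" using that(3) by auto
    then show ?thesis using P that unfolding position_def by blast
  qed (use ij in auto)
qed (use P ij in \<open>auto simp: position_def\<close>)

text \<open>Moves the head from \<open>(h, c)\<close> to \<open>(Suc h, k)\<close>. Every open
  variable of layer \<open>h\<close> gets the default \<open>False\<close>, which leaves
  \<open>c\<close> as its only active node; the final updates override this default for the chosen
  pointer and activate its target.\<close>

definition complete_layer :: "nat \<Rightarrow> nat \<Rightarrow> nat \<Rightarrow> (nat \<Rightarrow> bool option) \<Rightarrow> nat \<Rightarrow> bool option" where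
  "complete_layer h c k \<rho> = (\<rho>
     ++ (\<lambda>x. if \<rho> x = None \<and> (\<exists>j l. x = av h j \<or> x = bv h j \<or> x = sv h j l) then Some False else None))
     (sv h c k \<mapsto> True, av (Suc h) k \<mapsto> True, bv (Suc h) k \<mapsto> True)"

text \<open>The point is that layer \<open>h\<close> becomes satisfied: its other nodes are
  inactive, the head points to \<open>k\<close> alone, the target is active, and no other node of
  the layer points to \<open>k\<close>.\<close>

lemma position_extend:
  assumes P: "position m \<rho> h c T" and k: "k < m" "(Suc h, k) \<notin> T"
  shows "position m (complete_layer h c k \<rho>) (Suc h) k T"
    and "\<rho> \<subseteq>\<^sub>m complete_layer h c k \<rho>"
    and "\<And>l. complete_layer h c k \<rho> (sv h c l) = Some (l = k)"
proof -
  let ?\<rho> = "complete_layer h c k \<rho>"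
  have None: "\<rho> (av (Suc h) k) = None" "\<rho> (bv (Suc h) k) = None" "\<rho> (sv h c k) = None"
    "\<And>l. \<rho> (sv (Suc h) k l) = None"
  proof -
    have "h \<le> Suc h" "(Suc h, k) \<noteq> (h, c)" by auto
    then show "\<rho> (av (Suc h) k) = None" "\<rho> (bv (Suc h) k) = None" "\<rho> (sv (Suc h) k l) = None" for l
      using P k unfolding position_def by blast+
    \<comment> \<open>A false pointer of the head would put its target into
      \<open>T\<close>.\<close>
    have "\<rho> (sv h c k) \<noteq> Some True" "\<rho> (sv h c k) \<noteq> Some False"
      using P k unfolding position_def by blast+
    then show "\<rho> (sv h c k) = None" by (metis (full_types) not_None_eq)
  qed
  show le: "\<rho> \<subseteq>\<^sub>m ?\<rho>"
    using None by (auto simp: map_le_def complete_layer_def map_add_def)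
  show out: "?\<rho> (sv h c l) = Some (l = k)" for l
  proof -
    have "\<rho> (sv h c l) \<noteq> Some True" using P unfolding position_def by blast
    then show ?thesis by (auto simp: complete_layer_def map_add_def split: option.splits)
  qed
  have head: "?\<rho> (av (Suc h) k) = Some True" "?\<rho> (bv (Suc h) k) = Some True"
    by (auto simp: complete_layer_def)
  have other: "?\<rho> (av h j) = Some False \<or> ?\<rho> (bv h j) = Some False" if "j \<noteq> c" for j
  proof (cases "(h, j) \<in> T")
    case True
    then have "\<rho> (av h j) = Some False \<or> \<rho> (bv h j) = Some False"
      using P unfolding position_def by blast
    then show ?thesis by (auto simp: complete_layer_def map_add_def)
  next
    case False
    then have "\<rho> (av h j) = None" using P that unfolding position_def by blast
    then show ?thesis by (auto simp: complete_layer_def map_add_def)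
  qed
  \<comment> \<open>A dead node pointing to \<open>k\<close> would force \<open>(Suc h, k)\<close>
    into \<open>T\<close>, and an untouched node receives the default.\<close>
  have inj: "?\<rho> (sv h j k) = Some False" if "j \<noteq> c" for j
  proof (cases "(h, j) \<in> T")
    case True
    then have "\<rho> (sv h j k) \<noteq> Some True" using P k unfolding position_def by blast
    then show ?thesis using that
      by (auto simp: complete_layer_def map_add_def split: option.splits)
  next
    case False
    then have "\<rho> (sv h j k) = None" using P that unfolding position_def by blast
    then show ?thesis using that by (auto simp: complete_layer_def map_add_def)
  qed
  have later: "?\<rho> (av i j) = \<rho> (av i j)" "?\<rho> (bv i j) = \<rho> (bv i j)" if "i > h" "(i, j) \<noteq> (Suc h, k)" for i j
    using that by (auto simp: complete_layer_def map_add_def)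
  have later': "?\<rho> (sv i j l) = \<rho> (sv i j l)" if "i > h" for i j l
    using that by (auto simp: complete_layer_def map_add_def)
  have "\<exists>l\<in>C. lit_true ?\<rho> l" if "C \<in> layer m h" for C
  proof -
    have *: "\<exists>l\<in>C. lit_true ?\<rho> l" if "j \<noteq> c" "inactive h j \<subseteq> C" for j C
      using other[OF that(1)] that(2) unfolding inactive_def by (metis insert_subset lit_true.simps(2))
    \<comment> \<open>After this, the edge clauses are open only for the chosen pointer, from
      \<open>c\<close> to \<open>k\<close>.\<close>
    have **: "no_edge h j l \<subseteq> C \<Longrightarrow> \<exists>l\<in>C. lit_true ?\<rho> l" if "j \<noteq> c \<or> l \<noteq> k" for j l C
      using *[of j C] out[of l] that by (cases "j = c") (force simp: inactive_def no_edge_def)+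
    from \<open>C \<in> layer m h\<close> consider
        (1) j where "C = has_edge m h j"
      | (2) j l where "C = edge_a h j l"
      | (3) j l where "C = edge_b h j l"
      | (4) l j j' where "C = edge_inj h l j j'" "j' < j"
      unfolding layer_def by fast
    then show ?thesis
    proof cases
      case 1
      then show ?thesis
        using *[of j C] out[of k] k(1) by (cases "j = c") (force simp: has_edge_def)+
    next
      case 2
      then show ?thesis
        using **[of j l C] head by (cases "j = c \<and> l = k") (auto simp: edge_a_def)
    next
      case 3
      then show ?thesis
        using **[of j l C] head by (cases "j = c \<and> l = k") (auto simp: edge_b_def)
    next
      case 4
      then show ?thesis
        using **[of j l C] inj[of j'] by (cases "j = c \<and> l = k") (auto simp: edge_inj_def)
    qed
  qed
  moreover have "\<forall>i<h. \<forall>C\<in>layer m i. \<exists>l\<in>C. lit_true ?\<rho> l"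
    by (rule satisfied_mono[OF _ le]) (use P in \<open>simp add: position_def\<close>)
  ultimately have sat: "\<forall>i<Suc h. \<forall>C\<in>layer m i. \<exists>l\<in>C. lit_true ?\<rho> l"
    by (auto simp: less_Suc_eq)
  have mono: "?\<rho> x = Some v" if "\<rho> x = Some v" for x v
    using le that by (metis domI map_le_def)
  have dead: "?\<rho> (av i j) = Some False \<or> ?\<rho> (bv i j) = Some False" if "(i, j) \<in> T" for i j
  proof -
    have "\<rho> (av i j) = Some False \<or> \<rho> (bv i j) = Some False"
      using P that unfolding position_def by blast
    then show ?thesis using mono by blast
  qed
  have untouched: "?\<rho> (av i j) = None \<and> ?\<rho> (bv i j) = None \<and> (\<forall>l. ?\<rho> (sv i j l) = None)"
    if "Suc h \<le> i" "(i, j) \<notin> T" "(i, j) \<noteq> (Suc h, k)" for i j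
  proof -
    have "(i, j) \<noteq> (h, c)" "h \<le> i" using that by auto
    then have "\<rho> (av i j) = None \<and> \<rho> (bv i j) = None \<and> (\<forall>k. \<rho> (sv i j k) = None)"
      using P that(2) unfolding position_def by blast
    then show ?thesis using later[of i j] later'[of i j] that by simp
  qed
  have dead_edge: "(Suc i, l) \<in> T"
    if "Suc h \<le> i" "(i, j) \<in> T" "?\<rho> (sv i j l) = Some True" for i j l
  proof -
    have "h \<le> i" "\<rho> (sv i j l) = Some True" using that later' by auto
    then show ?thesis using P that(2) unfolding position_def by blast
  qed
  have new: "?\<rho> (sv (Suc h) k l) = None" for l using later'[of "Suc h"] None by simp
  have start: "?\<rho> (av 0 0) = Some True" "?\<rho> (bv 0 0) = Some True"
    by (rule mono, use P in \<open>simp add: position_def\<close>)+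
  have fin: "finite T" using P by (simp add: position_def)
  show "position m ?\<rho> (Suc h) k T"
    unfolding position_def
    by (intro conjI allI impI fin sat start head dead k(2) untouched[THEN conjunct1]
        untouched[THEN conjunct2, THEN conjunct1] untouched[THEN conjunct2, THEN conjunct2, rule_format])
      (simp_all add: new, use dead_edge in blast)
qed

text \<open>A node other than the head is dead or untouched, so its activity literals keep a clause
  from being falsified. The head has no true pointer, and its pointers are not all false because
  fewer than \<open>m\<close> nodes are dead.\<close>

lemma position_not_falsified:
  assumes P: "position m \<rho> h c T" and h: "h < n" and T: "card T < m"
    and C: "C \<in> path_cnf n m"
  shows "\<exists>l\<in>C. \<not> lit_false \<rho> l"
proof -
  have fresh: "\<exists>k<m. (Suc h, k) \<notin> T"
  proof (rule ccontr)
    assume "\<not> ?thesis"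
    then have "Pair (Suc h) ` {..<m} \<subseteq> T" by auto
    then have "card (Pair (Suc h) ` {..<m}) \<le> card T"
      using P by (intro card_mono) (auto simp: position_def)
    then show False using T by (simp add: card_image inj_on_def)
  qed
  have other: "\<exists>l\<in>C. \<not> lit_false \<rho> l" if "h \<le> i" "(i, j) \<noteq> (h, c)" "inactive i j \<subseteq> C" for i j C
  proof (cases "(i, j) \<in> T")
    case True
    then have "\<rho> (av i j) = Some False \<or> \<rho> (bv i j) = Some False"
      using P unfolding position_def by blast
    then show ?thesis using that(3) unfolding inactive_def
      by (metis insert_subset lit_true.simps(2) lit_true_not_false)
  next
    case False
    then have "\<rho> (av i j) = None" using P that unfolding position_def by blast
    then show ?thesis using that(3) unfolding inactive_def
      by (metis insert_subset lit_false.simps(2) option.distinct(1))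
  qed
  have edge: "\<exists>l\<in>C. \<not> lit_false \<rho> l" if "h \<le> i" "no_edge i j k \<subseteq> C" for i j k C
  proof (cases "(i, j) = (h, c)")
    case True
    then have "\<rho> (sv i j k) \<noteq> Some True" using P unfolding position_def by blast
    then show ?thesis using that(2) unfolding no_edge_def
      by (metis insert_subset lit_false.simps(2))
  next
    case False
    then show ?thesis using other that by (auto simp: no_edge_def inactive_def)
  qed
  from C consider (start) "C = {Pos (av 0 0)} \<or> C = {Pos (bv 0 0)}"
    | (layer) i where "i < n" "C \<in> layer m i" | (goal) j where "C = inactive n j"
    unfolding path_cnf_def by blast
  then show ?thesis
  proof cases
    case start
    then show ?thesis using P by (auto simp: position_def)
  next
    case goal
    \<comment> \<open>The head is above the last layer, so \<open>(n, j)\<close> is another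
      node.\<close>
    then show ?thesis using other[of n j C] h by auto
  next
    case layer
    show ?thesis
    proof (cases "i < h")
      case True
      then have "\<exists>l\<in>C. lit_true \<rho> l" using P layer unfolding position_def by blast
      then show ?thesis using lit_true_not_false by blast
    next
      case False
      then have i: "h \<le> i" by simp
      from layer(2) consider
          (1) j where "C = has_edge m i j" | (2) j l where "no_edge i j l \<subseteq> C"
        unfolding layer_def edge_a_def edge_b_def edge_inj_def by fast
      then show ?thesis
      proof cases
        case 2
        then show ?thesis using edge i by blast
      next
        case 1
        show ?thesis
        proof (cases "(i, j) = (h, c)")
          case True
          from fresh obtain k where k: "k < m" "(Suc h, k) \<notin> T" by blast
          then have "\<rho> (sv h c k) \<noteq> Some False" using P unfolding position_def by blast
          then show ?thesis using 1 True k(1) by (force simp: has_edge_def)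
        next
          case False
          then show ?thesis using other[of i j C] 1 i by (auto simp: has_edge_def)
        qed
      qed
    qed
  qed
qed

text \<open>Two budgets pay for the remaining points. A point costs either one layer or up to two
  dead nodes, whence the factor 2.\<close>

definition scores :: "nat \<Rightarrow> nat \<Rightarrow> (nat \<Rightarrow> bool option) \<Rightarrow> nat \<Rightarrow> bool" where
  "scores n m \<rho> p \<longleftrightarrow> (\<exists>h c T. position m \<rho> h c T \<and> h + p \<le> n \<and> card T + 2 * p \<le> m)"

lemma scoresI: "position m \<rho> h c T \<Longrightarrow> h + p \<le> n \<Longrightarrow> card T + 2 * p \<le> m \<Longrightarrow> scores n m \<rho> p"
  unfolding scores_def by blast

text \<open>Only queries about untouched nodes and about pointers from the head to live nodes cost
  anything, and for these either answer can be honoured at the price of one point.\<close>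

lemma scores_query:
  assumes "scores n m \<rho> (Suc p)" and x: "\<rho> x = None"
  shows "(\<exists>\<rho>' b. \<rho> \<subseteq>\<^sub>m \<rho>' \<and> \<rho>' x = Some b \<and> scores n m \<rho>' (Suc p)) \<or>
    (\<forall>b. \<exists>\<rho>'. \<rho> \<subseteq>\<^sub>m \<rho>' \<and> \<rho>' x = Some b \<and> scores n m \<rho>' p)"
proof -
  from assms(1) obtain h c T where P: "position m \<rho> h c T"
    and hp: "h + Suc p \<le> n" and Tp: "card T + 2 * Suc p \<le> m"
    unfolding scores_def by blast
  have fin: "finite T" using P by (simp add: position_def)
  have card_insert: "card (insert u T') \<le> Suc (card T')" if "finite T'" for u and T' :: "(nat \<times> nat) set"
    using that by (simp add: card_insert_if)
  consider
      (head) k where "k < m" "x = sv h c k" "(Suc h, k) \<notin> T"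
    | (a) i j where "h \<le> i" "(i, j) \<notin> T" "(i, j) \<noteq> (h, c)" "x = av i j"
    | (b) i j where "h \<le> i" "(i, j) \<notin> T" "(i, j) \<noteq> (h, c)" "x = bv i j"
    | (s) i j k where "h \<le> i" "(i, j) \<notin> T" "(i, j) \<noteq> (h, c)" "x = sv i j k"
    | (free) "\<And>i j. h \<le> i \<Longrightarrow> (i, j) \<notin> T \<Longrightarrow> (i, j) \<noteq> (h, c) \<Longrightarrow>
        x \<noteq> av i j \<and> x \<noteq> bv i j \<and> (\<forall>k. x \<noteq> sv i j k)"
        "\<And>k. k < m \<Longrightarrow> x = sv h c k \<Longrightarrow> (Suc h, k) \<in> T"
    by blast
  then show ?thesis
  proof cases
    case free
    then have "position m (\<rho>(x \<mapsto> False)) h c T" using position_free[OF P x] by blast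
    then have "scores n m (\<rho>(x \<mapsto> False)) (Suc p)" using hp Tp by (rule scoresI)
    moreover have "\<rho> \<subseteq>\<^sub>m \<rho>(x \<mapsto> False)" using x by (rule map_le_upd_None)
    ultimately show ?thesis by (intro disjI1) (metis fun_upd_same)
  next
    case a
    \<comment> \<open>The companion variable takes the opposite value, so the node dies whatever the
      answer is.\<close>
    have "\<exists>\<rho>'. \<rho> \<subseteq>\<^sub>m \<rho>' \<and> \<rho>' x = Some v \<and> scores n m \<rho>' p" for v
      using position_kill[OF P a(1-3), of v "\<not> v"] hp Tp card_insert[OF fin, of "(i, j)"] a(4)
      by (intro exI[of _ "\<rho>(av i j \<mapsto> v, bv i j \<mapsto> \<not> v)"] conjI scoresI) auto
    then show ?thesis by blast
  next
    case b
    have "\<exists>\<rho>'. \<rho> \<subseteq>\<^sub>m \<rho>' \<and> \<rho>' x = Some v \<and> scores n m \<rho>' p" for v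
      using position_kill[OF P b(1-3), of "\<not> v" v] hp Tp card_insert[OF fin, of "(i, j)"] b(4)
      by (intro exI[of _ "\<rho>(av i j \<mapsto> \<not> v, bv i j \<mapsto> v)"] conjI scoresI) auto
    then show ?thesis by blast
  next
    case s
    \<comment> \<open>A queried pointer can take any value once both its ends are dead. This is the
      move that may cost two nodes; its target lies below layer \<open>h\<close> and so is not the
      head.\<close>
    define \<rho>1 where "\<rho>1 = \<rho>(av i j \<mapsto> False, bv i j \<mapsto> False)"
    define T1 where "T1 = insert (i, j) T"
    have 1: "position m \<rho>1 h c T1" "\<rho> \<subseteq>\<^sub>m \<rho>1"
      using position_kill[OF P s(1-3), of False False] by (auto simp: \<rho>1_def T1_def)
    have x1: "\<rho>1 x = None" using x s(4) by (simp add: \<rho>1_def)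
    have "\<exists>\<rho>2 T2. position m \<rho>2 h c T2 \<and> \<rho>1 \<subseteq>\<^sub>m \<rho>2 \<and> \<rho>2 x = None \<and> T1 \<subseteq> T2 \<and>
      (Suc i, k) \<in> T2 \<and> card T2 \<le> Suc (card T1)"
    proof (cases "(Suc i, k) \<in> T1")
      case True
      then show ?thesis using 1 x1 by (intro exI[of _ \<rho>1] exI[of _ T1]) auto
    next
      case False
      then show ?thesis
        using position_kill[OF 1(1) _ False, of False False] x1 s(1,4) card_insert[of T1 "(Suc i, k)"] fin
        by (intro exI[of _ "\<rho>1(av (Suc i) k \<mapsto> False, bv (Suc i) k \<mapsto> False)"]
            exI[of _ "insert (Suc i, k) T1"]) (auto simp: T1_def)
    qed
    then obtain \<rho>2 T2 where 2: "position m \<rho>2 h c T2" "\<rho>1 \<subseteq>\<^sub>m \<rho>2" "\<rho>2 x = None" "T1 \<subseteq> T2"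
      "(Suc i, k) \<in> T2" "card T2 \<le> Suc (card T1)" by blast
    have "\<exists>\<rho>'. \<rho> \<subseteq>\<^sub>m \<rho>' \<and> \<rho>' x = Some v \<and> scores n m \<rho>' p" for v
    proof (intro exI conjI)
      show "\<rho> \<subseteq>\<^sub>m \<rho>2(x \<mapsto> v)"
        using 1(2) 2(2) map_le_upd_None[of \<rho>2 x v, OF 2(3)] by (meson map_le_trans)
      have "position m (\<rho>2(x \<mapsto> v)) h c T2"
        using position_dead_edge[OF 2(1), of i j k] 2 s(1,4) by (auto simp: T1_def)
      moreover have "card T2 + 2 * p \<le> m"
        using 2(6) card_insert[OF fin, of "(i, j)"] Tp by (auto simp: T1_def)
      ultimately show "scores n m (\<rho>2(x \<mapsto> v)) p" using hp by (intro scoresI) auto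
    qed simp
    then show ?thesis by blast
  next
    case head
    have "\<exists>\<rho>'. \<rho> \<subseteq>\<^sub>m \<rho>' \<and> \<rho>' x = Some v \<and> scores n m \<rho>' p" for v
    proof -
      \<comment> \<open>The answer \<open>True\<close> moves the head along the queried pointer, the
        answer \<open>False\<close> along another one. The node budget guarantees a second live
        target.\<close>
      have "\<exists>k'<m. (Suc h, k') \<notin> T \<and> k' \<noteq> k"
      proof (rule ccontr)
        assume "\<not> ?thesis"
        then have "Pair (Suc h) ` ({..<m} - {k}) \<subseteq> T" by auto
        then have "card (Pair (Suc h) ` ({..<m} - {k})) \<le> card T" using fin by (intro card_mono)
        then show False using Tp head(1) by (simp add: card_image inj_on_def)
      qed
      then obtain k' where k': "k' < m" "(Suc h, k') \<notin> T" "v \<longleftrightarrow> k = k'"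
        using head by (cases v) auto
      show ?thesis
        using position_extend[OF P k'(1,2)] k'(3) hp Tp head(2)
        by (intro exI[of _ "complete_layer h c k' \<rho>"] conjI scoresI) auto
    qed
    then show ?thesis by blast
  qed
qed

text \<open>With width \<open>2 * n\<close>, both budgets allow exactly \<open>n\<close> points at
  the start, where only node \<open>(0, 0)\<close> is set.\<close>

lemma tree_derives_path_cnf:
  assumes "tree_derives (path_cnf n (2 * n)) {} s"
  shows "2 ^ n \<le> s"
proof (rule delayer_lower_bound[OF _ _ assms, of "scores n (2 * n)"])
  show "\<exists>l\<in>C. \<not> lit_false \<rho> l" if "scores n (2 * n) \<rho> (Suc p)" "C \<in> path_cnf n (2 * n)" for \<rho> p C
    using that position_not_falsified[of "2 * n" \<rho> _ _ _ n C] by (fastforce simp: scores_def)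
  show "(\<exists>\<rho>' b. \<rho> \<subseteq>\<^sub>m \<rho>' \<and> \<rho>' x = Some b \<and> scores n (2 * n) \<rho>' (Suc p)) \<or>
      (\<forall>b. \<exists>\<rho>'. \<rho> \<subseteq>\<^sub>m \<rho>' \<and> \<rho>' x = Some b \<and> scores n (2 * n) \<rho>' p)"
    if "scores n (2 * n) \<rho> (Suc p)" "\<rho> x = None" for \<rho> p x
    using scores_query[OF that] .
  have "position (2 * n) [av 0 0 \<mapsto> True, bv 0 0 \<mapsto> True] 0 0 {}"
    by (auto simp: position_def)
  then show "scores n (2 * n) [av 0 0 \<mapsto> True, bv 0 0 \<mapsto> True] n" by (rule scoresI) auto
qed simp


section \<open>Short MaxRes refutations\<close>

text \<open>A resource reading of derivations: \<open>K\<close> is consumed, the arbitrary context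
  \<open>J\<close> is preserved, and \<open>J'\<close> absorbs unwanted side clauses. The step count
  is an upper bound, so that estimates compose.\<close>

definition derives :: "clause multiset \<Rightarrow> clause multiset \<Rightarrow> nat \<Rightarrow> bool" where
  "derives K L s \<longleftrightarrow>
     (\<forall>J. \<exists>J' s'. s' \<le> s \<and> (maxsat_resolution ^^ s') (K + J) (L + J + J'))"

lemma derives_refl: "derives K K s"
  unfolding derives_def by (intro allI exI[of _ "{#}"] exI[of _ "0::nat"]) simp

lemma derives_le: "derives K L s \<Longrightarrow> s \<le> t \<Longrightarrow> derives K L t"
  unfolding derives_def by (meson order.trans)

lemma derives_drop: "derives K (L + R) s \<Longrightarrow> derives K L s"
  unfolding derives_def
proof
  fix J
  assume "\<forall>J. \<exists>J' s'. s' \<le> s \<and> (maxsat_resolution ^^ s') (K + J) (L + R + J + J')"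
  then obtain J' s' where "s' \<le> s" "(maxsat_resolution ^^ s') (K + J) (L + R + J + J')"
    by blast
  then show "\<exists>J' s'. s' \<le> s \<and> (maxsat_resolution ^^ s') (K + J) (L + J + J')"
    by (intro exI[of _ "R + J'"] exI[of _ s']) (simp add: ac_simps)
qed

text \<open>The leftover of the first derivation joins the context of the second.\<close>

lemma derives_trans:
  assumes "derives K L s" "derives L N t"
  shows "derives K N (s + t)"
  unfolding derives_def
proof
  fix J
  obtain J1 s1 where 1: "s1 \<le> s" "(maxsat_resolution ^^ s1) (K + J) (L + J + J1)"
    using assms(1) unfolding derives_def by blast
  obtain J2 s2 where 2: "s2 \<le> t" "(maxsat_resolution ^^ s2) (L + (J + J1)) (N + (J + J1) + J2)"
    using assms(2) unfolding derives_def by blast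
  have "(maxsat_resolution ^^ (s1 + s2)) (K + J) (N + J + (J1 + J2))"
    using relpowp_trans[OF 1(2), of s2] 2(2) by (simp add: ac_simps)
  then show "\<exists>J' s'. s' \<le> s + t \<and> (maxsat_resolution ^^ s') (K + J) (N + J + J')"
    using 1(1) 2(1) add_mono by blast
qed

lemma derives_frame:
  assumes "derives K L s"
  shows "derives (K + R) (L + R) s"
  unfolding derives_def
proof
  fix J
  obtain J' s' where "s' \<le> s" "(maxsat_resolution ^^ s') (K + (R + J)) (L + (R + J) + J')"
    using assms unfolding derives_def by blast
  then show "\<exists>J' s'. s' \<le> s \<and> (maxsat_resolution ^^ s') (K + R + J) (L + R + J + J')"
    by (auto simp: add.assoc)
qed

lemma derives_add:
  assumes "derives K L s" "derives K' L' t"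
  shows "derives (K + K') (L + L') (s + t)"
proof -
  have "derives (L + K') (L + L') t" using derives_frame[OF assms(2), of L] by (simp only: add.commute)
  then show ?thesis by (rule derives_trans[OF derives_frame[OF assms(1), of K']])
qed

lemma derives_sum:
  assumes "finite A" "\<And>i. i \<in> A \<Longrightarrow> derives (K i) (L i) s"
  shows "derives (\<Sum>i\<in>A. K i) (\<Sum>i\<in>A. L i) (card A * s)"
  using assms by (induction A rule: finite_induct) (auto intro: derives_refl derives_add)

lemma derives_resolution_list:
  assumes "distinct as" "distinct bs" "Pos x \<notin> set as" "Neg x \<notin> set bs"
    and "L \<subseteq># filter_mset (\<lambda>C. \<not> tautologous C) (maxsat_consequents x as bs)"
  shows "derives {#insert (Pos x) (set as), insert (Neg x) (set bs)#} L 1"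
  unfolding derives_def
proof
  fix J
  let ?K = "{#insert (Pos x) (set as), insert (Neg x) (set bs)#}"
  let ?N = "filter_mset (\<lambda>C. \<not> tautologous C) (maxsat_consequents x as bs)"
  have "maxsat_resolution (?K + J) (replace_clauses (?K + J) ?K (maxsat_consequents x as bs))"
    using assms(1-4) by (intro maxsat_resolution.intros) auto
  also have "replace_clauses (?K + J) ?K (maxsat_consequents x as bs) = L + J + (?N - L)"
    using assms(5) by (simp add: replace_clauses_def ac_simps)
  finally show "\<exists>J' s'. s' \<le> 1 \<and> (maxsat_resolution ^^ s') (?K + J) (L + J + J')"
    by (intro exI[of _ "?N - L"] exI[of _ "1::nat"]) (simp only: relpowp_1 order.refl simp_thms)
qed

text \<open>Enumerating \<open>A\<close> with \<open>l\<close> first makes the first side clause of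
  the other premise contain nothing of \<open>A\<close> except the complement of \<open>l\<close>.
  This freedom of order is what allows a consumed clause to be recovered in a slightly weakened
  form.\<close>

lemma derives_resolution_side:
  assumes "finite A" "finite B" "Pos x \<notin> A" "Neg x \<notin> B" "\<not> tautologous (A \<union> B)"
    and "l \<in> A" "\<not> tautologous (insert (compl_lit l) (insert (Neg x) B))"
  shows "derives {#insert (Pos x) A, insert (Neg x) B#}
    {#A \<union> B, insert (compl_lit l) (insert (Neg x) B)#} 1"
proof -
  obtain as where as: "set as = A - {l}" "distinct as"
    using finite_distinct_list[of "A - {l}"] assms(1) by blast
  obtain bs where bs: "set bs = B" "distinct bs"
    using finite_distinct_list[OF assms(2)] by blast
  have A: "set (l # as) = A" using as assms(6) by auto
  have "derives {#insert (Pos x) (set (l # as)), insert (Neg x) (set bs)#}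
    {#A \<union> B, insert (compl_lit l) (insert (Neg x) B)#} 1"
  proof (rule derives_resolution_list)
    have "insert (compl_lit l) (insert (Neg x) B) \<in># side_clauses (Neg x) bs (l # as)"
      \<comment> \<open>Index 0 takes the empty prefix of \<open>l # as\<close>.\<close>
      unfolding side_clauses_def using bs by (auto simp: image_iff intro!: bexI[of _ 0])
    then have "{#insert (compl_lit l) (insert (Neg x) B)#} \<subseteq># side_clauses (Neg x) bs (l # as)"
      by simp
    then have "{#A \<union> B#} + {#insert (compl_lit l) (insert (Neg x) B)#} \<subseteq>#
        maxsat_consequents x (l # as) bs"
      unfolding maxsat_consequents_def A bs
      by (intro subset_mset.add_mono) (auto intro: mset_subset_eq_add_left subset_mset.order_trans)
    from multiset_filter_mono[OF this, of "\<lambda>C. \<not> tautologous C"]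
    show "{#A \<union> B, insert (compl_lit l) (insert (Neg x) B)#} \<subseteq>#
        filter_mset (\<lambda>C. \<not> tautologous C) (maxsat_consequents x (l # as) bs)"
      using assms(5,7) by (simp add: add_mset_commute)
  qed (use as bs A assms(3,4) in auto)
  then show ?thesis by (simp only: A bs)
qed

lemma derives_resolution:
  assumes "finite A" "finite B" "Pos x \<notin> A" "Neg x \<notin> B" "\<not> tautologous (A \<union> B)"
  shows "derives {#insert (Pos x) A, insert (Neg x) B#} {#A \<union> B#} 1"
proof -
  obtain as where as: "set as = A" "distinct as" using finite_distinct_list[OF assms(1)] by blast
  obtain bs where bs: "set bs = B" "distinct bs" using finite_distinct_list[OF assms(2)] by blast
  have "derives {#insert (Pos x) (set as), insert (Neg x) (set bs)#} {#A \<union> B#} 1"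
    by (rule derives_resolution_list) (use as bs assms(3-5) in \<open>auto simp: maxsat_consequents_def\<close>)
  then show ?thesis by (simp only: as bs)
qed

section \<open>Refuting the formulas backwards, layer by layer\<close>

text \<open>What is left of \<open>inactive (i + 1) k\<close> after it has been used for the possible predecessors
  \<open>j < t\<close>. The resolution steps reproduce it as a side clause, so that nothing has to be copied.\<close>
definition unreached :: "nat \<Rightarrow> nat \<Rightarrow> nat \<Rightarrow> clause" where
  "unreached i k t = inactive (Suc i) k \<union> (\<lambda>j. Pos (sv i j k)) ` {..<t}"

text \<open>\<open>edge_inj i k j j'\<close> is \<open>no_edge i j k\<close> plus the negation of
  one positive literal, so each step removes one such literal. The bound \<open>t \<le> j\<close>
  keeps \<open>sv i j k\<close> out of the positive literals and hence the clauses
  non-tautologous.\<close>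

lemma derives_edge_inj:
  assumes "t \<le> j"
  shows "derives ({#no_edge i j k \<union> (\<lambda>j. Pos (sv i j k)) ` {..<t}#} + (\<Sum>j'<t. {#edge_inj i k j j'#}))
    {#no_edge i j k#} t"
  using assms
proof (induction t)
  case 0
  then show ?case by (simp add: derives_refl)
next
  case (Suc t)
  let ?S = "\<lambda>t. no_edge i j k \<union> (\<lambda>j. Pos (sv i j k)) ` {..<t}"
  have "derives {#insert (Pos (sv i t k)) (?S t), insert (Neg (sv i t k)) (no_edge i j k)#}
      {#?S t \<union> no_edge i j k#} 1"
    using Suc.prems by (intro derives_resolution) (auto simp: tautologous_def no_edge_def)
  moreover have "insert (Pos (sv i t k)) (?S t) = ?S (Suc t)" by (auto simp: lessThan_Suc)
  moreover have "?S t \<union> no_edge i j k = ?S t" by auto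
  ultimately have "derives {#?S (Suc t), edge_inj i k j t#} {#?S t#} 1"
    by (simp add: edge_inj_def)
  from derives_trans[OF derives_frame[OF this] Suc.IH[OF Suc_leD[OF Suc.prems]]]
  show ?case by (simp add: ac_simps)
qed

text \<open>The turn of predecessor \<open>j\<close>: two steps remove the activity variables of the
  target, and \<open>j\<close> further steps remove the pointers from earlier predecessors. The
  first step also leaves \<open>unreached i k (Suc j)\<close> for the next predecessor.\<close>

lemma derives_no_edge:
  "derives ({#unreached i k j#} + ({#edge_a i j k, edge_b i j k#} + (\<Sum>j'<j. {#edge_inj i k j j'#})))
    ({#unreached i k (Suc j)#} + {#no_edge i j k#}) (j + 2)"
proof -
  let ?P = "(\<lambda>j. Pos (sv i j k)) ` {..<j}"
  let ?A = "no_edge i j k"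
  \<comment> \<open>The distinguished literal is \<open>Neg (sv i j k)\<close>; its complement is
    the literal by which \<open>unreached\<close> grows.\<close>
  have "derives {#insert (Pos (bv (Suc i) k)) ?A, insert (Neg (bv (Suc i) k)) (insert (Neg (av (Suc i) k)) ?P)#}
      {#?A \<union> insert (Neg (av (Suc i) k)) ?P,
        insert (compl_lit (Neg (sv i j k))) (insert (Neg (bv (Suc i) k)) (insert (Neg (av (Suc i) k)) ?P))#} 1"
    by (intro derives_resolution_side) (auto simp: tautologous_def no_edge_def)
  moreover have "insert (compl_lit (Neg (sv i j k))) (insert (Neg (bv (Suc i) k)) (insert (Neg (av (Suc i) k)) ?P))
      = unreached i k (Suc j)"
    by (auto simp: unreached_def inactive_def lessThan_Suc)
  moreover have "insert (Neg (bv (Suc i) k)) (insert (Neg (av (Suc i) k)) ?P) = unreached i k j"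
    by (auto simp: unreached_def inactive_def)
  ultimately have 1: "derives {#edge_b i j k, unreached i k j#}
      {#?A \<union> insert (Neg (av (Suc i) k)) ?P, unreached i k (Suc j)#} 1"
    by (simp add: edge_b_def)
  have "derives {#insert (Pos (av (Suc i) k)) ?A, insert (Neg (av (Suc i) k)) (?A \<union> ?P)#}
      {#?A \<union> (?A \<union> ?P)#} 1"
    by (intro derives_resolution) (auto simp: tautologous_def no_edge_def)
  then have 2: "derives {#edge_a i j k, ?A \<union> insert (Neg (av (Suc i) k)) ?P#} {#?A \<union> ?P#} 1"
    by (simp add: edge_a_def Un_assoc[symmetric])
  have "derives ({#edge_b i j k, unreached i k j#} + ({#edge_a i j k#} + (\<Sum>j'<j. {#edge_inj i k j j'#})))
     ({#?A \<union> insert (Neg (av (Suc i) k)) ?P, unreached i k (Suc j)#}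
        + ({#edge_a i j k#} + (\<Sum>j'<j. {#edge_inj i k j j'#}))) 1"
    by (rule derives_frame[OF 1])
  from derives_trans[OF this, of "{#?A \<union> ?P#} + ({#unreached i k (Suc j)#} + (\<Sum>j'<j. {#edge_inj i k j j'#}))" 1]
  have "derives ({#edge_b i j k, unreached i k j#} + ({#edge_a i j k#} + (\<Sum>j'<j. {#edge_inj i k j j'#})))
     ({#?A \<union> ?P#} + ({#unreached i k (Suc j)#} + (\<Sum>j'<j. {#edge_inj i k j j'#}))) (1 + 1)"
    using derives_frame[OF 2, of "{#unreached i k (Suc j)#} + (\<Sum>j'<j. {#edge_inj i k j j'#})"]
    by (simp add: ac_simps add_mset_commute)
  from derives_trans[OF this, of "{#?A#} + {#unreached i k (Suc j)#}" j]
  show ?thesis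
    using derives_frame[OF derives_edge_inj[OF order.refl, of i j k], of "{#unreached i k (Suc j)#}"]
    by (simp add: ac_simps add_mset_commute)
qed

text \<open>The remainder of the inactivity clause is handed from one predecessor to the next, so a
  single copy serves all of them.\<close>

lemma derives_column:
  "derives ({#inactive (Suc i) k#} +
      (\<Sum>j<t. {#edge_a i j k, edge_b i j k#} + (\<Sum>j'<j. {#edge_inj i k j j'#})))
    ({#unreached i k t#} + (\<Sum>j<t. {#no_edge i j k#})) (t * (t + 2))"
proof (induction t)
  case 0
  then show ?case by (simp add: unreached_def derives_refl)
next
  case (Suc t)
  let ?E = "\<lambda>j. {#edge_a i j k, edge_b i j k#} + (\<Sum>j'<j. {#edge_inj i k j j'#})"
  let ?N = "\<lambda>t. \<Sum>j<t. {#no_edge i j k#}"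
  have 1: "derives (({#inactive (Suc i) k#} + (\<Sum>j<t. ?E j)) + ?E t)
      (({#unreached i k t#} + ?N t) + ?E t) (t * (t + 2))"
    by (rule derives_frame[OF Suc.IH])
  have eq: "({#unreached i k t#} + ?N t) + ?E t = ({#unreached i k t#} + ?E t) + ?N t"
    by (simp only: ac_simps)
  have 2: "derives (({#unreached i k t#} + ?E t) + ?N t)
      (({#unreached i k (Suc t)#} + {#no_edge i t k#}) + ?N t) (t + 2)"
    by (rule derives_frame[OF derives_no_edge])
  have "derives ({#inactive (Suc i) k#} + (\<Sum>j<Suc t. ?E j))
      ({#unreached i k (Suc t)#} + ?N (Suc t)) (t * (t + 2) + (t + 2))"
    using derives_trans[OF 1[unfolded eq] 2] by (simp only: sum.lessThan_Suc ac_simps)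
  then show ?case by (rule derives_le) simp
qed

text \<open>Truncating \<open>has_edge\<close> to the first \<open>t\<close> targets gives the
  induction: each \<open>no_edge\<close> clause removes the last target, and with no targets left
  the clause is \<open>inactive i j\<close>.\<close>

lemma derives_inactive:
  "derives ({#has_edge t i j#} + (\<Sum>k<t. {#no_edge i j k#})) {#inactive i j#} t"
proof (induction t)
  case 0
  then show ?case by (simp add: has_edge_def derives_refl)
next
  case (Suc t)
  have "derives {#insert (Pos (sv i j t)) (has_edge t i j), insert (Neg (sv i j t)) (inactive i j)#}
      {#has_edge t i j \<union> inactive i j#} 1"
    by (intro derives_resolution) (auto simp: tautologous_def has_edge_def inactive_def)
  moreover have "insert (Pos (sv i j t)) (has_edge t i j) = has_edge (Suc t) i j"
    by (auto simp: has_edge_def lessThan_Suc)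
  moreover have "insert (Neg (sv i j t)) (inactive i j) = no_edge i j t"
    by (auto simp: no_edge_def inactive_def)
  moreover have "has_edge t i j \<union> inactive i j = has_edge t i j" by (auto simp: has_edge_def)
  ultimately have "derives {#has_edge (Suc t) i j, no_edge i j t#} {#has_edge t i j#} 1" by simp
  from derives_trans[OF derives_frame[OF this] Suc.IH]
  show ?case by (simp add: ac_simps add_mset_commute)
qed

text \<open>The edge clauses are grouped by target \<open>k\<close>, the way
  \<open>derives_column\<close> consumes them.\<close>

definition layer_mset :: "nat \<Rightarrow> nat \<Rightarrow> clause multiset" where
  "layer_mset m i = (\<Sum>j<m. {#has_edge m i j#}) +
     (\<Sum>k<m. \<Sum>j<m. {#edge_a i j k, edge_b i j k#} + (\<Sum>j'<j. {#edge_inj i k j j'#}))"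

text \<open>The columns yield exactly one copy of \<open>no_edge i j k\<close> for every pair.
  Regrouped by source \<open>j\<close>, these are the copies that \<open>derives_inactive\<close>
  needs.\<close>

lemma derives_layer:
  "derives ((\<Sum>k<m. {#inactive (Suc i) k#}) + layer_mset m i) (\<Sum>j<m. {#inactive i j#})
    (m * (m * (m + 2)) + m * m)"
proof -
  have "derives ({#inactive (Suc i) k#} +
        (\<Sum>j<m. {#edge_a i j k, edge_b i j k#} + (\<Sum>j'<j. {#edge_inj i k j j'#})))
      (\<Sum>j<m. {#no_edge i j k#}) (m * (m + 2))" for k
    using derives_drop[of _ "\<Sum>j<m. {#no_edge i j k#}" "{#unreached i k m#}"] derives_column
    by (simp add: add.commute)
  from derives_frame[OF derives_sum[OF finite_lessThan[of m], OF this], where R = "\<Sum>j<m. {#has_edge m i j#}"]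
  have "derives ((\<Sum>k<m. {#inactive (Suc i) k#}) + layer_mset m i)
      ((\<Sum>k<m. \<Sum>j<m. {#no_edge i j k#}) + (\<Sum>j<m. {#has_edge m i j#})) (m * (m * (m + 2)))"
    by (simp only: sum.distrib layer_mset_def card_lessThan ac_simps)
  moreover have "(\<Sum>k<m. \<Sum>j<m. {#no_edge i j k#}) + (\<Sum>j<m. {#has_edge m i j#})
      = (\<Sum>j<m. {#has_edge m i j#} + (\<Sum>k<m. {#no_edge i j k#}))"
    by (subst sum.swap) (simp only: sum.distrib ac_simps)
  moreover have "derives (\<Sum>j<m. {#has_edge m i j#} + (\<Sum>k<m. {#no_edge i j k#}))
      (\<Sum>j<m. {#inactive i j#}) (card {..<m} * m)"
    by (rule derives_sum) (simp_all only: finite_lessThan derives_inactive)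
  ultimately show ?thesis using derives_trans by simp
qed

lemma derives_layers:
  "derives ((\<Sum>k<m. {#inactive n k#}) + (\<Sum>i<n. layer_mset m i)) (\<Sum>j<m. {#inactive 0 j#})
    (n * (m * (m * (m + 2)) + m * m))"
proof (induction n)
  case 0
  then show ?case by (simp add: derives_refl)
next
  case (Suc n)
  from derives_trans[OF derives_frame[OF derives_layer[where m = m and i = n], where R = "\<Sum>i<n. layer_mset m i"] Suc.IH]
  show ?case by (simp add: ac_simps)
qed

lemma derives_empty: "derives ({#inactive 0 0#} + {#{Pos (av 0 0)}, {Pos (bv 0 0)}#}) {#{}#} 2"
proof -
  have "derives {#insert (Pos (av 0 0)) {}, insert (Neg (av 0 0)) {Neg (bv 0 0)}#}
      {#{} \<union> {Neg (bv 0 0)}#} 1"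
    by (intro derives_resolution) (auto simp: tautologous_def)
  then have "derives {#{Pos (av 0 0)}, inactive 0 0#} {#{Neg (bv 0 0)}#} 1"
    by (simp add: inactive_def)
  from derives_frame[OF this, of "{#{Pos (bv 0 0)}#}"]
  have 1: "derives ({#inactive 0 0#} + {#{Pos (av 0 0)}, {Pos (bv 0 0)}#})
      {#{Pos (bv 0 0)}, {Neg (bv 0 0)}#} 1"
    by (simp add: add_mset_commute)
  have "derives {#insert (Pos (bv 0 0)) {}, insert (Neg (bv 0 0)) {}#} {#{} \<union> {}#} 1"
    by (intro derives_resolution) (auto simp: tautologous_def)
  from derives_trans[OF 1 this] show ?thesis by (simp add: numeral_2_eq_2)
qed

section \<open>The formulas as multisets of clauses\<close>

lemma mset_set_image:
  assumes "finite A" "inj_on f A"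
  shows "mset_set (f ` A) = (\<Sum>a\<in>A. {#f a#})"
proof -
  have "image_mset f (mset_set A) = (\<Sum>a\<in>A. {#f a#})"
    using assms(1) by (induction A rule: finite_induct) auto
  then show ?thesis by (simp add: image_mset_mset_set[OF assms(2)])
qed

text \<open>\<open>mset_set\<close> counts equal clauses once, so passing to sums over indices needs
  injective families. In each case a negative literal identifies the indices.\<close>

lemma clause_inj:
  "has_edge m i j = has_edge m i j' \<Longrightarrow> j = j'"
  "edge_a i j k = edge_a i j' k' \<Longrightarrow> j = j' \<and> k = k'"
  "edge_b i j k = edge_b i j' k' \<Longrightarrow> j = j' \<and> k = k'"
  "inactive i j = inactive i j' \<Longrightarrow> j = j'"
proof -
  show "has_edge m i j = has_edge m i j' \<Longrightarrow> j = j'"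
    by (drule arg_cong[of _ _ "\<lambda>C. Neg (av i j) \<in> C"]) (auto simp: clause_defs)
  show "edge_a i j k = edge_a i j' k' \<Longrightarrow> j = j' \<and> k = k'"
    by (drule arg_cong[of _ _ "\<lambda>C. Neg (sv i j k) \<in> C"]) (auto simp: clause_defs)
  show "edge_b i j k = edge_b i j' k' \<Longrightarrow> j = j' \<and> k = k'"
    by (drule arg_cong[of _ _ "\<lambda>C. Neg (sv i j k) \<in> C"]) (auto simp: clause_defs)
  show "inactive i j = inactive i j' \<Longrightarrow> j = j'"
    by (drule arg_cong[of _ _ "\<lambda>C. Neg (av i j) \<in> C"]) (auto simp: clause_defs)
qed

text \<open>The activity literal reveals \<open>j\<close>; the pointer literals then reveal
  \<open>k\<close> and, being different, \<open>j'\<close>.\<close>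

lemma edge_inj_inj:
  assumes eq: "edge_inj i k j j' = edge_inj i l t t'" and "j' < j" "t' < t"
  shows "k = l \<and> j = t \<and> j' = t'"
proof -
  have "Neg (av i j) \<in> edge_inj i l t t'" unfolding eq[symmetric] by (simp add: clause_defs)
  then have j: "j = t" by (simp add: clause_defs)
  have "Neg (sv i j k) \<in> edge_inj i l t t'" unfolding eq[symmetric] by (simp add: clause_defs)
  then have k: "k = l" using assms(3) j by (auto simp: clause_defs)
  have "Neg (sv i j' k) \<in> edge_inj i l t t'" unfolding eq[symmetric] by (simp add: clause_defs)
  then show ?thesis using j k assms(2) by (auto simp: clause_defs)
qed

lemma clause_neq:
  "has_edge m i j \<noteq> edge_a i j' k" "has_edge m i j \<noteq> edge_b i j' k" "has_edge m i j \<noteq> edge_inj i k j' t"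
  "edge_a i j k \<noteq> edge_b i j' k'" "edge_a i j k \<noteq> edge_inj i k' j' t" "edge_b i j k \<noteq> edge_inj i k' j' t"
proof -
  have "Neg (sv i j' k) \<notin> has_edge m i j" "Neg (sv i j' k) \<in> edge_a i j' k"
    "Neg (sv i j' k) \<in> edge_b i j' k" "Neg (sv i j' k) \<in> edge_inj i k j' t"
    by (auto simp: clause_defs)
  then show "has_edge m i j \<noteq> edge_a i j' k" "has_edge m i j \<noteq> edge_b i j' k"
    "has_edge m i j \<noteq> edge_inj i k j' t"
    by metis+
  have "Pos (av (Suc i) k) \<in> edge_a i j k" "Pos (av (Suc i) k) \<notin> edge_b i j' k'"
    "Pos (av (Suc i) k) \<notin> edge_inj i k' j' t"
    by (auto simp: clause_defs)
  then show "edge_a i j k \<noteq> edge_b i j' k'" "edge_a i j k \<noteq> edge_inj i k' j' t"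
    by metis+
  have "Pos (bv (Suc i) k) \<in> edge_b i j k" "Pos (bv (Suc i) k) \<notin> edge_inj i k' j' t"
    by (auto simp: clause_defs)
  then show "edge_b i j k \<noteq> edge_inj i k' j' t"
    by metis
qed

lemma mset_set_layer: "mset_set (layer m i) = layer_mset m i"
proof -
  let ?I = "{..<m} \<times> (SIGMA j:{..<m}. {..<j})"
  let ?U = "has_edge m i ` {..<m}"
  let ?A = "(\<lambda>(j, k). edge_a i j k) ` ({..<m} \<times> {..<m})"
  let ?B = "(\<lambda>(j, k). edge_b i j k) ` ({..<m} \<times> {..<m})"
  let ?C = "(\<lambda>(k, j, j'). edge_inj i k j j') ` ?I"
  have "?U \<inter> ?A = {}" "(?U \<union> ?A) \<inter> ?B = {}" "(?U \<union> ?A \<union> ?B) \<inter> ?C = {}"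
    by (auto simp: disjoint_iff clause_neq clause_neq[symmetric])
  then have "mset_set (layer m i) = mset_set ?U + mset_set ?A + mset_set ?B + mset_set ?C"
    unfolding layer_def by (simp only: mset_set_Union finite_Un finite_imageI finite_lessThan
        finite_cartesian_product finite_SigmaI simp_thms)
  moreover have "mset_set ?U = (\<Sum>j<m. {#has_edge m i j#})"
    by (rule mset_set_image) (auto intro: inj_onI dest: clause_inj)
  moreover have "mset_set ?A = (\<Sum>k<m. \<Sum>j<m. {#edge_a i j k#})"
  proof -
    have "mset_set ?A = (\<Sum>(j, k)\<in>{..<m} \<times> {..<m}. {#edge_a i j k#})"
      by (subst mset_set_image) (auto intro!: inj_onI dest: clause_inj simp: case_prod_beta)
    then show ?thesis by (subst sum.swap) (simp only: sum.cartesian_product)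
  qed
  moreover have "mset_set ?B = (\<Sum>k<m. \<Sum>j<m. {#edge_b i j k#})"
  proof -
    have "mset_set ?B = (\<Sum>(j, k)\<in>{..<m} \<times> {..<m}. {#edge_b i j k#})"
      by (subst mset_set_image) (auto intro!: inj_onI dest: clause_inj simp: case_prod_beta)
    then show ?thesis by (subst sum.swap) (simp only: sum.cartesian_product)
  qed
  moreover have "mset_set ?C = (\<Sum>k<m. \<Sum>j<m. \<Sum>j'<j. {#edge_inj i k j j'#})"
  proof -
    have "mset_set ?C = (\<Sum>(k, j, j')\<in>?I. {#edge_inj i k j j'#})"
      by (subst mset_set_image) (auto intro!: inj_onI dest: edge_inj_inj simp: case_prod_beta)
    then show ?thesis by (simp add: sum.Sigma sum.cartesian_product)
  qed
  moreover have "{#edge_a i j k, edge_b i j k#} = {#edge_a i j k#} + {#edge_b i j k#}" for j k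
    by simp
  ultimately show ?thesis
    unfolding layer_mset_def by (simp only: sum.distrib ac_simps)
qed

text \<open>Negative activity literals reveal the layer of a clause. Hence different layers share no
  clause.\<close>

lemma layer_level: "C \<in> layer m i \<Longrightarrow> (\<exists>j. Neg (av i' j) \<in> C) \<longleftrightarrow> i' = i"
  by (auto simp: layer_def clause_defs)

lemma mset_set_layers: "mset_set (\<Union>i<n. layer m i) = (\<Sum>i<n. layer_mset m i)"
proof (induction n)
  case (Suc n)
  have "layer m n \<inter> (\<Union>i<n. layer m i) = {}"
    using layer_level by (metis (no_types, lifting) UN_E disjoint_iff lessThan_iff less_irrefl)
  then show ?case
    using Suc.IH by (simp add: lessThan_Suc mset_set_Union finite_layer mset_set_layer)
qed simp

lemma mset_set_path_cnf:
  "mset_set (path_cnf n m) = {#{Pos (av 0 0)}, {Pos (bv 0 0)}#} + (\<Sum>i<n. layer_mset m i)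
     + (\<Sum>j<m. {#inactive n j#})"
proof -
  have "C \<notin> layer m i" if "C \<in> inactive n ` {..<m}" "i < n" for C i
    using that layer_level[of C m i n] by (auto simp: inactive_def)
  then have 1: "({{Pos (av 0 0)}, {Pos (bv 0 0)}} \<union> (\<Union>i<n. layer m i)) \<inter> inactive n ` {..<m} = {}"
    by (auto simp: inactive_def)
  have 2: "{{Pos (av 0 0)}, {Pos (bv 0 0)}} \<inter> (\<Union>i<n. layer m i) = {}"
    using layer_level by fastforce
  have 3: "mset_set (inactive n ` {..<m}) = (\<Sum>j<m. {#inactive n j#})"
    by (rule mset_set_image) (auto intro: inj_onI dest: clause_inj)
  have fin: "finite {{Pos (av 0 0)}, {Pos (bv 0 0)}}" "finite (\<Union>i<n. layer m i)"
    by (simp_all add: finite_layer)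
  have "mset_set (path_cnf n m) = mset_set {{Pos (av 0 0)}, {Pos (bv 0 0)}}
      + mset_set (\<Union>i<n. layer m i) + mset_set (inactive n ` {..<m})"
    unfolding path_cnf_def mset_set_Union[OF finite_UnI[OF fin] finite_imageI[OF finite_lessThan] 1]
      mset_set_Union[OF fin 2] ..
  then show ?thesis by (simp add: 3 mset_set_layers)
qed

lemma MaxRes_path_cnf:
  assumes "m > 0"
  shows "\<exists>s \<le> n * (m * (m * (m + 2)) + m * m) + 2. MaxRes (path_cnf n m) s"
proof -
  let ?S = "{#{Pos (av 0 0)}, {Pos (bv 0 0)}#}"
  \<comment> \<open>Of the clauses derived for layer 0, only the one for the start node is
    kept.\<close>
  have "(\<Sum>j<m. {#inactive 0 j#}) = {#inactive 0 0#} + (\<Sum>j\<in>{..<m} - {0}. {#inactive 0 j#})"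
    using assms by (intro sum.remove) auto
  then have "derives ((\<Sum>k<m. {#inactive n k#}) + (\<Sum>i<n. layer_mset m i)) {#inactive 0 0#}
      (n * (m * (m * (m + 2)) + m * m))"
    using derives_layers derives_drop by metis
  from derives_trans[OF derives_frame[OF this] derives_empty]
  have "derives (mset_set (path_cnf n m)) {#{}#} (n * (m * (m * (m + 2)) + m * m) + 2)"
    by (simp add: mset_set_path_cnf ac_simps)
  then obtain J s where "s \<le> n * (m * (m * (m + 2)) + m * m) + 2"
    "(maxsat_resolution ^^ s) (mset_set (path_cnf n m) + {#}) ({#{}#} + {#} + J)"
    unfolding derives_def by blast
  then show ?thesis unfolding MaxRes_def by (intro exI[of _ s]) auto
qed

lemma MaxRes_imp_MaxResW: "MaxRes F s \<Longrightarrow> MaxResW F s"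
proof -
  have "(maxsat_resolution ^^ s) K L \<Longrightarrow>
      ((\<lambda>K L. maxsat_resolution K L \<or> maxsat_weakening K L) ^^ s) K L" for K L
    by (erule relpowp_mono[rotated]) blast
  then show "MaxRes F s \<Longrightarrow> MaxResW F s" unfolding MaxRes_def MaxResW_def by blast
qed

section \<open>The separation\<close>

text \<open>The polynomial \<open>p\<close> may have negative coefficients and need not be monotone;
  this majorant is monotone, so an upper bound on the size can be substituted.\<close>

lemma poly_upper_bound:
  fixes p :: "real poly"
  shows "\<exists>K d. K > 0 \<and> (\<forall>x\<ge>0. \<bar>poly p x\<bar> \<le> K * (1 + x) ^ d)"
proof (induction p)
  case 0
  show ?case by (intro exI[of _ 1] exI[of _ 0]) simp
next
  case (pCons a p)
  then obtain K d where K: "K > 0" "\<And>x. x \<ge> 0 \<Longrightarrow> \<bar>poly p x\<bar> \<le> K * (1 + x) ^ d" by blast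
  have "\<bar>poly (pCons a p) x\<bar> \<le> (\<bar>a\<bar> + K) * (1 + x) ^ Suc d" if x: "x \<ge> 0" for x
  proof -
    have "\<bar>poly (pCons a p) x\<bar> \<le> \<bar>a\<bar> * 1 + x * \<bar>poly p x\<bar>"
      using x abs_triangle_ineq[of a "x * poly p x"] by (simp add: abs_mult)
    also have "\<dots> \<le> \<bar>a\<bar> * (1 + x) ^ Suc d + (1 + x) * (K * (1 + x) ^ d)"
      using x K by (intro add_mono mult_left_mono mult_mono one_le_power) auto
    finally show ?thesis by (simp add: algebra_simps)
  qed
  then show ?case using K(1) by (intro exI[of _ "\<bar>a\<bar> + K"] exI[of _ "Suc d"]) auto
qed

lemma path_cnf_superpolynomial:
  fixes p :: "real poly"
  shows "\<exists>n s. n > 0 \<and> MaxRes (path_cnf n (2 * n)) s \<and>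
    poly p (real (s + cnf_size (path_cnf n (2 * n)))) < 2 ^ n"
proof -
  obtain K d where K: "K > 0" "\<And>x. x \<ge> 0 \<Longrightarrow> \<bar>poly p x\<bar> \<le> K * (1 + x) ^ d"
    using poly_upper_bound by blast
  \<comment> \<open>The degree 5 comes from the formula size, about \<open>n\<close> layers with
    order \<open>n ^ 3\<close> clauses of width of order \<open>n\<close>. The factor 200 exceeds
    176, the sum of the coefficients computed below.\<close>
  have "eventually (\<lambda>n::nat. K * (1 + 200 * real n ^ 5) ^ d < 2 ^ n) at_top"
    using K(1) by real_asymp
  then obtain n :: nat where n: "n > 0" "K * (1 + 200 * real n ^ 5) ^ d < 2 ^ n"
    by (metis (mono_tags, lifting) eventually_at_top_linorder eventually_gt_at_top eventually_conj order.refl)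
  obtain s where s: "MaxRes (path_cnf n (2 * n)) s"
    "s \<le> n * (2 * n * (2 * n * (2 * n + 2)) + 2 * n * (2 * n)) + 2"
    using MaxRes_path_cnf[of "2 * n" n] n(1) by auto
  have pow: "n ^ i \<le> n ^ 5" if "i \<le> 5" for i using that n(1) by (intro power_increasing) auto
  have "s + cnf_size (path_cnf n (2 * n)) \<le> n * (2 * n * (2 * n * (2 * n + 2)) + 2 * n * (2 * n)) + 2
      + (2 + n * (2 * n + 2 * (2 * n)\<^sup>2 + (2 * n) ^ 3) + 2 * n) * (2 * n + 5)"
    using s(2) cnf_size_path_cnf by (rule add_mono)
  also have "\<dots> = 16 * n ^ 5 + 64 * n ^ 4 + 56 * n ^ 3 + 14 * n ^ 2 + 14 * n + 12"
    by algebra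
  also have "\<dots> \<le> 200 * n ^ 5"
    using pow[of 0] pow[of 1] pow[of 2] pow[of 3] pow[of 4] by simp
  finally have "real (s + cnf_size (path_cnf n (2 * n))) \<le> 200 * real n ^ 5"
    by (metis of_nat_le_iff of_nat_mult of_nat_numeral of_nat_power)
  then have "K * (1 + real (s + cnf_size (path_cnf n (2 * n)))) ^ d \<le> K * (1 + 200 * real n ^ 5) ^ d"
    using K(1) by (intro mult_left_mono power_mono) auto
  then have "poly p (real (s + cnf_size (path_cnf n (2 * n)))) < 2 ^ n"
    using K(2)[of "real (s + cnf_size (path_cnf n (2 * n)))"] n(2) by linarith
  then show ?thesis using n(1) s(1) by blast
qed

theorem theorem3p8:
  shows "\<not> simulates TreeRes MaxRes \<and> \<not> simulates TreeRes MaxResW"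
proof -
  \<comment> \<open>Both claims at once: the argument only needs that \<open>P\<close> inherits the
    short MaxRes refutations.\<close>
  have "\<not> simulates TreeRes P" if P: "\<And>F s. MaxRes F s \<Longrightarrow> P F s" for P
  proof
    assume "simulates TreeRes P"
    then obtain p :: "real poly" where p: "\<And>F s. is_cnf F \<Longrightarrow> unsatisfiable F \<Longrightarrow> P F s \<Longrightarrow>
        \<exists>t. TreeRes F t \<and> real t \<le> poly p (real (s + cnf_size F))"
      unfolding simulates_def by blast
    obtain n s where n: "n > 0" "MaxRes (path_cnf n (2 * n)) s"
      "poly p (real (s + cnf_size (path_cnf n (2 * n)))) < 2 ^ n"
      using path_cnf_superpolynomial by blast
    obtain t where t: "TreeRes (path_cnf n (2 * n)) t"
      "real t \<le> poly p (real (s + cnf_size (path_cnf n (2 * n))))"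
      using p[OF is_cnf_path_cnf unsatisfiable_path_cnf P[OF n(2)]] n(1) by auto
    have "(2::nat) ^ n \<le> t" using t(1) tree_derives_path_cnf unfolding TreeRes_def by blast
    then have "2 ^ n \<le> real t" by (metis of_nat_le_iff of_nat_numeral of_nat_power)
    then show False using t(2) n(3) by linarith
  qed
  then show ?thesis using MaxRes_imp_MaxResW by blast
qed

end
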